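(* If $N=2$ or $N=3$, then $U_t(s)=e(V_t(s))$ for all $t\le N$ and all $s\in S$.
   Context: Setting (vector-valued Markov decision process). Integers $N\ge2$ and $m\ge1$ are fixed. $S$ is a finite set of states; for each $s\in S$, $A_s$ is a nonempty compact set of actions; $A=\bigcup_{s\in S}A_s$. For $t=1,\dots,N-1$, $s\in S$, $a\in A_s$, $R_t(s,a)\in\mathbb{R}^m$ is a vector reward, with components continuous in $a\in A_s$; $p_t(j\mid s,a)$ is the probability of state $j\in S$ at epoch $t+1$ given action $a$ in state $s$ at epoch $t$, continuous in $a\in A_s$. $R_N(s)\in\mathbb{R}^m$ is the terminal reward. A Markovian decision rule is a map $d:S\to A$ with $d(s)\in A_s$; the set $D$ of decision rules is assumed compact (topology of pointwise convergence). A (Markovian) policy is a sequence $\pi=(d_1,\dots,d_{N-1})$ of decision rules; $P_W$ is the set of all of them. Expected total rewards: $u_N^\pi(s)=R_N(s)$ and, for $t<N$, $u_t^\pi(s)=R_t(s,d_t(s))+\sum_{j\in S}p_t(j\mid s,d_t(s))\,u_{t+1}^\pi(j)$. Set $V_t(s)=\{u_t^\pi(s):\pi\in P_W\}$ for $t\le N$, $s\in S$. Order on $\mathbb{R}^m$: $x\ge y$ iff $x_i\ge y_i$ for all $i$. For $X\subseteq\mathbb{R}^m$, $e(X)=\{x\in X:\forall y\in X,\ y\ge x\Rightarrow y=x\}$. White's equations: define by backward recursion $U_N(s)=\{R_N(s)\}$ and, for $t<N$, $$U_t(s)=e\Bigl(\bigl\{R_t(s,a)+\textstyle\sum_{j\in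 S}p_t(j\mid s,a)v_j : a\in A_s,\ v_j\in U_{t+1}(j)\ \text{for all } j\in S\bigr\}\Bigr).$$ *)

theory Defs
  imports "HOL-Analysis.Analysis"
begin

text \<open>The order on \<^typ>\<open>real ^ 'm\<close> is the library's componentwise one.\<close>

definition efficient :: "'b::ord set \<Rightarrow> 'b set" where
  "efficient X = {x \<in> X. \<forall>y\<in>X. y \<ge> x \<longrightarrow> y = x}"

definition decision_rules :: "'s set \<Rightarrow> ('s \<Rightarrow> 'a set) \<Rightarrow> ('s \<Rightarrow> 'a) set" where
  "decision_rules S A = Pi\<^sub>E S A"

definition policies ::
  "nat \<Rightarrow> 's set \<Rightarrow> ('s \<Rightarrow> 'a set) \<Rightarrow> (nat \<Rightarrow> 's \<Rightarrow> 'a) set" where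
  "policies N S A = (\<Pi>\<^sub>E t\<in>{1..<N}. decision_rules S A)"

text \<open>
  Here \<open>p t s a j\<close> is the probability of moving to state \<open>j\<close> when action \<open>a\<close> is taken in
  state \<open>s\<close> at epoch \<open>t\<close>. Epochs run from \<open>1\<close> to \<open>N\<close>; the terminal reward \<open>RN\<close> (below) is unconstrained
  and therefore not a parameter of the locale.
\<close>

locale vector_mdp =
  fixes N :: nat
    and S :: "'s set"
    and A :: "'s \<Rightarrow> 'a::topological_space set"
    and R :: "nat \<Rightarrow> 's \<Rightarrow> 'a \<Rightarrow> real ^ 'm"
    and p :: "nat \<Rightarrow> 's \<Rightarrow> 'a \<Rightarrow> 's \<Rightarrow> real"
  assumes N_ge_2: "N \<ge> 2"
    and finite_S: "finite S"
    and A_nonempty: "s \<in> S \<Longrightarrow> A s \<noteq> {}"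
    and A_compact: "s \<in> S \<Longrightarrow> compact (A s)"
    and R_continuous:
      "\<lbrakk>t \<in> {1..<N}; s \<in> S\<rbrakk> \<Longrightarrow> continuous_on (A s) (\<lambda>a. R t s a $ i)"
    and p_nonneg:
      "\<lbrakk>t \<in> {1..<N}; s \<in> S; a \<in> A s; j \<in> S\<rbrakk> \<Longrightarrow> 0 \<le> p t s a j"
    and p_sum:
      "\<lbrakk>t \<in> {1..<N}; s \<in> S; a \<in> A s\<rbrakk> \<Longrightarrow> (\<Sum>j\<in>S. p t s a j) = 1"
    and p_continuous:
      "\<lbrakk>t \<in> {1..<N}; s \<in> S; j \<in> S\<rbrakk> \<Longrightarrow> continuous_on (A s) (\<lambda>a. p t s a j)"
    and decision_rules_compact:
      "compactin (product_topology (\<lambda>_. euclidean) S) (decision_rules S A)"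
      \<comment> \<open>pointwise convergence; redundant given compactness of each \<open>A s\<close> (Tychonoff)\<close>

function total_reward ::
  "nat \<Rightarrow> 's set \<Rightarrow> (nat \<Rightarrow> 's \<Rightarrow> 'a \<Rightarrow> real ^ 'm) \<Rightarrow> ('s \<Rightarrow> real ^ 'm)
    \<Rightarrow> (nat \<Rightarrow> 's \<Rightarrow> 'a \<Rightarrow> 's \<Rightarrow> real) \<Rightarrow> (nat \<Rightarrow> 's \<Rightarrow> 'a) \<Rightarrow> nat \<Rightarrow> 's \<Rightarrow> real ^ 'm" where
  "total_reward N S R RN p \<pi> t s =
     (if t \<ge> N then RN s
      else R t s (\<pi> t s)
        + (\<Sum>j\<in>S. p t s (\<pi> t s) j *\<^sub>R total_reward N S R RN p \<pi> (Suc t) j))"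
  by pat_completeness auto
termination
  by (relation "Wellfounded.measure (\<lambda>(N, S, R, RN, p, \<pi>, t, s). N - t)") auto

declare total_reward.simps [simp del]

definition reward_set ::
  "nat \<Rightarrow> 's set \<Rightarrow> ('s \<Rightarrow> 'a set) \<Rightarrow> (nat \<Rightarrow> 's \<Rightarrow> 'a \<Rightarrow> real ^ 'm) \<Rightarrow> ('s \<Rightarrow> real ^ 'm)
    \<Rightarrow> (nat \<Rightarrow> 's \<Rightarrow> 'a \<Rightarrow> 's \<Rightarrow> real) \<Rightarrow> nat \<Rightarrow> 's \<Rightarrow> (real ^ 'm) set" where
  "reward_set N S A R RN p t s = {total_reward N S R RN p \<pi> t s |\<pi>. \<pi> \<in> policies N S A}"

function white_set ::
  "nat \<Rightarrow> 's set \<Rightarrow> ('s \<Rightarrow> 'a set) \<Rightarrow> (nat \<Rightarrow> 's \<Rightarrow> 'a \<Rightarrow> real ^ 'm) \<Rightarrow> ('s \<Rightarrow> real ^ 'm)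
    \<Rightarrow> (nat \<Rightarrow> 's \<Rightarrow> 'a \<Rightarrow> 's \<Rightarrow> real) \<Rightarrow> nat \<Rightarrow> 's \<Rightarrow> (real ^ 'm) set" where
  "white_set N S A R RN p t s =
     (if t \<ge> N then {RN s}
      else efficient {R t s a + (\<Sum>j\<in>S. p t s a j *\<^sub>R v j) |a v.
             a \<in> A s \<and> (\<forall>j\<in>S. v j \<in> white_set N S A R RN p (Suc t) j)})"
  by pat_completeness auto
termination
  by (relation "Wellfounded.measure (\<lambda>(N, S, A, R, RN, p, t, s). N - t)") auto

declare white_set.simps [simp del]

end

(*
  White's recursion and the set of attainable rewards are linked by two facts.  In the last two
  decision epochs the continuation rewards of different states can be chosen independently of each
  other, because no epoch with a shared later policy remains; hence V_t arises from V_(t+1) by the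
  same one-step operator that White applies to U_(t+1).  Moreover V_(N-1) is compact, so each of its
  points is dominated by an efficient one (maximise the sum of the components above the point), and
  by monotonicity of the one-step operator nothing efficient is lost on replacing V_(N-1) by U_(N-1).
*)

theory Submission
  imports Defs
begin

lemma efficient_subset: "efficient X \<subseteq> X"
  by (auto simp: efficient_def)

lemma efficient_singleton [simp]: "efficient {x} = {x}"
  by (auto simp: efficient_def)

text \<open>Passing from a point of \<open>Y\<close> to one of \<open>X\<close> above it gives both
  inclusions. If \<open>x\<close> is efficient in \<open>X\<close> and x \<le> y with y in
  \<open>Y\<close>, then x \<le> y \<le> z for some z in \<open>X\<close>, and z = x closes the
  chain by antisymmetry. An efficient point of \<open>Y\<close> equals any point of \<open>X\<close>
  above it.\<close>

lemma efficient_eq_of_dominating: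
  fixes X Y :: "'b::order set"
  assumes "X \<subseteq> Y" and dom: "\<And>y. y \<in> Y \<Longrightarrow> \<exists>x\<in>X. y \<le> x"
  shows "efficient X = efficient Y"
proof (intro set_eqI iffI)
  fix x assume x: "x \<in> efficient X"
  have "y = x" if y: "y \<in> Y" "x \<le> y" for y
  proof -
    obtain z where z: "z \<in> X" "y \<le> z"
      using dom y by blast
    then have "z = x"
      using x y by (auto simp: efficient_def)
    then show ?thesis
      using y z by simp
  qed
  then show "x \<in> efficient Y"
    using x assms(1) by (auto simp: efficient_def)
next
  fix x assume x: "x \<in> efficient Y"
  then obtain z where "z \<in> X" "x \<le> z"
    using dom by (auto simp: efficient_def)
  then have "x \<in> X"
    using x assms(1) by (auto simp: efficient_def)
  then show "x \<in> efficient X"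
    using x assms(1) by (auto simp: efficient_def)
qed

lemma compact_imp_dominated_by_efficient:
  fixes X :: "(real ^ 'm) set"
  assumes "compact X" "x \<in> X"
  obtains y where "y \<in> efficient X" "x \<le> y"
proof -
  \<comment> \<open>Any point of \<open>X\<close> above a member of \<open>F\<close> is again above
    \<open>x\<close>, hence in \<open>F\<close>, so a maximiser over \<open>F\<close> competes with
    all points of \<open>X\<close> above it.\<close>
  define F where "F = X \<inter> {y. x \<le> y}"
  have "closed {y. x \<le> y}"
    unfolding less_eq_vec_def by (intro closed_Collect_all closed_Collect_le continuous_intros)
  then have "compact F"
    unfolding F_def using assms(1) by (rule compact_Int_closed[rotated])
  moreover have "F \<noteq> {}"
    using assms(2) by (auto simp: F_def)
  moreover have "continuous_on F (\<lambda>y. \<Sum>i\<in>UNIV. y $ i)"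
    by (intro continuous_intros)
  ultimately obtain y where y: "y \<in> F" and
    max: "\<And>z. z \<in> F \<Longrightarrow> (\<Sum>i\<in>UNIV. z $ i) \<le> (\<Sum>i\<in>UNIV. y $ i)"
    by (metis continuous_attains_sup)
  have "z = y" if z: "z \<in> X" "y \<le> z" for z
  proof -
    have "z \<in> F"
      using y z by (auto simp: F_def)
    moreover have le: "y $ i \<le> z $ i" for i
      using z(2) by (simp add: less_eq_vec_def)
    \<comment> \<open>Maximality forces equal sums; with componentwise inequality this leaves no
      component where \<open>z\<close> is strictly larger.\<close>
    ultimately have "(\<Sum>i\<in>UNIV. y $ i) = (\<Sum>i\<in>UNIV. z $ i)"
      by (intro antisym[OF sum_mono max]) auto
    then have "y $ i = z $ i" for i
      using le by (intro sum_mono_inv[of "\<lambda>i. y $ i" UNIV "\<lambda>i. z $ i" i]) auto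
    then show ?thesis
      by (simp add: vec_eq_iff)
  qed
  then have "y \<in> efficient X" "x \<le> y"
    using y by (auto simp: efficient_def F_def)
  then show thesis
    by (rule that)
qed

context vector_mdp
begin

text \<open>The set inside White's equation, with the continuation sets as a parameter so that
  \<open>white_set\<close>, \<open>reward_set\<close> and singletons can all be inserted.\<close>

definition one_step :: "nat \<Rightarrow> 's \<Rightarrow> ('s \<Rightarrow> (real ^ 'm) set) \<Rightarrow> (real ^ 'm) set" where
  "one_step t s W = {R t s a + (\<Sum>j\<in>S. p t s a j *\<^sub>R v j) |a v. a \<in> A s \<and> (\<forall>j\<in>S. v j \<in> W j)}"

lemma one_step_cong:
  "(\<And>j. j \<in> S \<Longrightarrow> W j = W' j) \<Longrightarrow> one_step t s W = one_step t s W'"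
  by (simp add: one_step_def)

lemma one_step_mono:
  "(\<And>j. j \<in> S \<Longrightarrow> W j \<subseteq> W' j) \<Longrightarrow> one_step t s W \<subseteq> one_step t s W'"
  by (fastforce simp: one_step_def)

text \<open>Transition probabilities are nonnegative, so keeping the action and raising each
  continuation vector raises the total.\<close>

lemma one_step_dominated:
  assumes "t \<in> {1..<N}" "s \<in> S"
    and dom: "\<And>j w. \<lbrakk>j \<in> S; w \<in> W' j\<rbrakk> \<Longrightarrow> \<exists>v\<in>W j. w \<le> v"
    and "y \<in> one_step t s W'"
  shows "\<exists>x\<in>one_step t s W. y \<le> x"
proof -
  obtain a w where a: "a \<in> A s" and w: "\<forall>j\<in>S. w j \<in> W' j"
    and y: "y = R t s a + (\<Sum>j\<in>S. p t s a j *\<^sub>R w j)"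
    using assms(4) by (auto simp: one_step_def)
  have "\<forall>j\<in>S. \<exists>v. v \<in> W j \<and> w j \<le> v"
    using dom w by blast
  then obtain v where v: "\<forall>j\<in>S. v j \<in> W j \<and> w j \<le> v j"
    by (auto dest: bchoice)
  have "y \<le> R t s a + (\<Sum>j\<in>S. p t s a j *\<^sub>R v j)"
    using v p_nonneg[OF assms(1,2) a]
    by (auto simp: y less_eq_vec_def intro!: sum_mono mult_left_mono)
  then show ?thesis
    using a v by (auto simp: one_step_def)
qed

text \<open>Once the continuation vectors are fixed only the action varies, and the set is a
  continuous image of the compact \<open>A s\<close>.\<close>

lemma compact_one_step_singleton:
  assumes "t \<in> {1..<N}" "s \<in> S"
  shows "compact (one_step t s (\<lambda>j. {w j}))"
proof -
  let ?f = "\<lambda>a. R t s a + (\<Sum>j\<in>S. p t s a j *\<^sub>R w j)"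
  have "continuous_on (A s) (\<lambda>a. \<chi> i. R t s a $ i)"
    using R_continuous[OF assms] by (rule continuous_on_vec_lambda)
  then have "continuous_on (A s) ?f"
    using p_continuous[OF assms] by (auto intro!: continuous_intros)
  then have "compact (?f ` A s)"
    using A_compact[OF assms(2)] by (rule compact_continuous_image)
  moreover have "one_step t s (\<lambda>j. {w j}) = ?f ` A s"
  proof -
    \<comment> \<open>\<open>v\<close> and \<open>w\<close> may differ outside \<open>S\<close>, but
      the sum does not see this.\<close>
    have "(\<Sum>j\<in>S. p t s a j *\<^sub>R v j) = (\<Sum>j\<in>S. p t s a j *\<^sub>R w j)"
      if "\<forall>j\<in>S. v j = w j" for a v
      using that by simp
    then show ?thesis
      by (force simp: one_step_def)
  qed
  ultimately show ?thesis
    by simp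
qed

lemma policies_nonempty: "policies N S A \<noteq> {}"
  using A_nonempty by (auto simp: policies_def decision_rules_def PiE_eq_empty_iff)

lemma policy_action:
  "\<lbrakk>\<pi> \<in> policies N S A; t \<in> {1..<N}; s \<in> S\<rbrakk> \<Longrightarrow> \<pi> t s \<in> A s"
  by (auto simp: policies_def decision_rules_def PiE_def Pi_def)

lemma policy_update:
  "\<lbrakk>\<pi> \<in> policies N S A; t \<in> {1..<N}; d \<in> decision_rules S A\<rbrakk>
    \<Longrightarrow> \<pi>(t := d) \<in> policies N S A"
  by (auto simp: policies_def PiE_def Pi_def extensional_def)

lemma reward_set_terminal: "reward_set N S A R RN p N s = {RN s}"
  using policies_nonempty by (auto simp: reward_set_def total_reward.simps)

lemma white_set_terminal: "white_set N S A R RN p N s = {RN s}"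
  by (simp add: white_set.simps)

lemma white_set_step:
  "t < N \<Longrightarrow> white_set N S A R RN p t s
    = efficient (one_step t s (white_set N S A R RN p (Suc t)))"
  by (subst white_set.simps) (simp add: one_step_def)

text \<open>At every decision epoch, a single policy witnesses the continuation rewards of all
  states at once.\<close>

lemma reward_set_subset_one_step:
  assumes "t \<in> {1..<N}" "s \<in> S"
  shows "reward_set N S A R RN p t s \<subseteq> one_step t s (reward_set N S A R RN p (Suc t))"
proof
  fix x assume "x \<in> reward_set N S A R RN p t s"
  then obtain \<pi> where \<pi>: "\<pi> \<in> policies N S A" and x: "x = total_reward N S R RN p \<pi> t s"
    by (auto simp: reward_set_def)
  have "x = R t s (\<pi> t s)
      + (\<Sum>j\<in>S. p t s (\<pi> t s) j *\<^sub>R total_reward N S R RN p \<pi> (Suc t) j)"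
    using assms(1) by (subst x, subst total_reward.simps) simp
  then show "x \<in> one_step t s (reward_set N S A R RN p (Suc t))"
    unfolding one_step_def reward_set_def
    using \<pi> policy_action[OF \<pi> assms] by blast
qed

text \<open>
  With at most one later decision, the policies witnessing the continuation rewards of the
  individual states can be merged into one: state \<open>j\<close> only needs its own action at \<open>Suc t\<close>.
\<close>

lemma one_step_subset_reward_set:
  assumes t: "t \<in> {1..<N}" and s: "s \<in> S" and late: "N \<le> Suc (Suc t)"
  shows "one_step t s (reward_set N S A R RN p (Suc t)) \<subseteq> reward_set N S A R RN p t s"
proof
  fix x assume "x \<in> one_step t s (reward_set N S A R RN p (Suc t))"
  then obtain a v where a: "a \<in> A s"
    and x: "x = R t s a + (\<Sum>j\<in>S. p t s a j *\<^sub>R v j)"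
    and v: "\<forall>j\<in>S. \<exists>\<rho>. v j = total_reward N S R RN p \<rho> (Suc t) j \<and> \<rho> \<in> policies N S A"
    by (auto simp: one_step_def reward_set_def)
  obtain \<rho> where \<rho>: "\<And>j. j \<in> S \<Longrightarrow> v j = total_reward N S R RN p (\<rho> j) (Suc t) j"
    "\<And>j. j \<in> S \<Longrightarrow> \<rho> j \<in> policies N S A"
    using bchoice[OF v] by blast
  obtain \<pi>\<^sub>0 where \<pi>\<^sub>0: "\<pi>\<^sub>0 \<in> policies N S A"
    using policies_nonempty by blast
  define d where "d = (\<lambda>j\<in>S. \<rho> j (Suc t) j)"
  \<comment> \<open>For Suc t = N there is no decision at \<open>Suc t\<close>, and an update there
    would violate the extensionality built into \<open>policies\<close>.\<close>
  define \<pi>\<^sub>1 where "\<pi>\<^sub>1 = (if Suc t < N then \<pi>\<^sub>0(Suc t := d) else \<pi>\<^sub>0)"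
  have "Suc t < N \<Longrightarrow> d \<in> decision_rules S A"
    using policy_action[OF \<rho>(2)] by (auto simp: d_def decision_rules_def)
  then have \<pi>\<^sub>1: "\<pi>\<^sub>1 \<in> policies N S A"
    using \<pi>\<^sub>0 policy_update[OF \<pi>\<^sub>0] t by (auto simp: \<pi>\<^sub>1_def)
  define \<pi> where "\<pi> = \<pi>\<^sub>1(t := (\<pi>\<^sub>1 t)(s := a))"
  have "(\<pi>\<^sub>1 t)(s := a) \<in> decision_rules S A"
    using \<pi>\<^sub>1 t a s
    by (auto simp: policies_def decision_rules_def PiE_def Pi_def extensional_def)
  then have \<pi>: "\<pi> \<in> policies N S A"
    unfolding \<pi>_def using policy_update[OF \<pi>\<^sub>1 t] by blast
  \<comment> \<open>Hence the reward at \<open>Suc t\<close> in state \<open>j\<close> depends on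
    the policy at most through its action at that epoch and state.\<close>
  have terminal: "total_reward N S R RN p \<sigma> (Suc (Suc t)) j = RN j" for \<sigma> j
    using late by (simp add: total_reward.simps)
  have "total_reward N S R RN p \<pi> (Suc t) j = v j" if "j \<in> S" for j
    using that \<rho>(1)[OF that]
    by (simp add: total_reward.simps[of N S R RN p _ "Suc t"] terminal \<pi>_def \<pi>\<^sub>1_def d_def)
  then have "x = total_reward N S R RN p \<pi> t s"
    using t by (subst total_reward.simps) (simp add: x, simp add: \<pi>_def)
  then show "x \<in> reward_set N S A R RN p t s"
    using \<pi> by (auto simp: reward_set_def)
qed

lemma reward_set_step:
  "\<lbrakk>t \<in> {1..<N}; s \<in> S; N \<le> Suc (Suc t)\<rbrakk>
    \<Longrightarrow> reward_set N S A R RN p t s = one_step t s (reward_set N S A R RN p (Suc t))"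
  by (intro equalityI reward_set_subset_one_step one_step_subset_reward_set)

text \<open>The singleton form makes compactness at the last decision epoch available.\<close>

lemma reward_set_last:
  assumes "t \<in> {1..<N}" "s \<in> S" "Suc t = N"
  shows "reward_set N S A R RN p t s = one_step t s (\<lambda>j. {RN j})"
  using reward_set_step[OF assms(1,2)] assms(3) by (simp add: reward_set_terminal cong: one_step_cong)

lemma white_set_last:
  assumes "t \<in> {1..<N}" "s \<in> S" "Suc t = N"
  shows "white_set N S A R RN p t s = efficient (reward_set N S A R RN p t s)"
  using assms white_set_step[of t RN s] reward_set_last[OF assms, of RN]
  by (simp add: white_set_terminal cong: one_step_cong)

lemma white_set_second_last:
  assumes t: "t \<in> {1..<N}" "s \<in> S" and last: "Suc (Suc t) = N"
  shows "white_set N S A R RN p t s = efficient (reward_set N S A R RN p t s)"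
proof -
  let ?V = "reward_set N S A R RN p (Suc t)"
  have t': "Suc t \<in> {1..<N}"
    using last by auto
  have "white_set N S A R RN p t s = efficient (one_step t s (\<lambda>j. efficient (?V j)))"
    using t white_set_step[of t RN s] white_set_last[OF t' _ last, of _ RN]
    by (simp cong: one_step_cong)
  also have "\<dots> = efficient (one_step t s ?V)"
  proof (rule efficient_eq_of_dominating)
    show "one_step t s (\<lambda>j. efficient (?V j)) \<subseteq> one_step t s ?V"
      by (intro one_step_mono efficient_subset)
    show "\<exists>x\<in>one_step t s (\<lambda>j. efficient (?V j)). y \<le> x" if "y \<in> one_step t s ?V" for y
    proof (rule one_step_dominated[OF t _ that])
      fix j w assume "j \<in> S" "w \<in> ?V j"
      moreover from \<open>j \<in> S\<close> have "compact (?V j)"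
        using reward_set_last[OF t' _ last] compact_one_step_singleton[OF t'] by simp
      ultimately show "\<exists>v\<in>efficient (?V j). w \<le> v"
        by (metis compact_imp_dominated_by_efficient)
    qed
  qed
  also have "\<dots> = efficient (reward_set N S A R RN p t s)"
    using reward_set_step[OF t] last by simp
  finally show ?thesis .
qed

text \<open>When N is 2 or 3, every epoch t \<ge> 1 satisfies \<open>N \<le> Suc (Suc t)\<close>, so
  the whole horizon is covered.\<close>

theorem white_set_eq_efficient_reward_set:
  assumes "t \<in> {1..N}" "s \<in> S" "N \<le> Suc (Suc t)"
  shows "white_set N S A R RN p t s = efficient (reward_set N S A R RN p t s)"
proof -
  consider "t = N" | "t \<in> {1..<N}" "Suc t = N" | "t \<in> {1..<N}" "Suc (Suc t) = N"
    using assms by force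
  then show ?thesis
  proof cases
    case 1
    then show ?thesis
      by (simp add: white_set_terminal reward_set_terminal)
  qed (use assms(2) white_set_last white_set_second_last in blast)+
qed

end

theorem corollary1:
  fixes N :: nat
    and S :: "'s set"
    and A :: "'s \<Rightarrow> 'a::topological_space set"
    and R :: "nat \<Rightarrow> 's \<Rightarrow> 'a \<Rightarrow> real ^ 'm"
    and RN :: "'s \<Rightarrow> real ^ 'm"
    and p :: "nat \<Rightarrow> 's \<Rightarrow> 'a \<Rightarrow> 's \<Rightarrow> real"
  assumes "vector_mdp N S A R p"
    and "N = 2 \<or> N = 3"
  shows "\<forall>t\<in>{1..N}. \<forall>s\<in>S.
           white_set N S A R RN p t s = efficient (reward_set N S A R RN p t s)"
  using assms(2) vector_mdp.white_set_eq_efficient_reward_set[OF assms(1)] by auto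

end
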